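(* Let $\chi:\Gamma(2)\to\mathbb{C}^\times$, $\chi(g)=\widetilde{\beta_1}(g)/\widetilde{\beta}(g)$, with $\widetilde{\beta_1},\widetilde{\beta}$ as in the context, and let $n_2=\begin{pmatrix}1&2\\0&1\end{pmatrix}$, $n_2^-=\begin{pmatrix}1&0\\2&1\end{pmatrix}$. For every $g\in\Gamma(2)$: (1) $\chi(\pm g)=\chi(g)$; (2) $\chi(gn_2)=\chi(g)\chi(n_2)$; (3) $\chi(gn_2^-)=\chi(g)\chi(n_2^-)$.
   Context: $\Gamma(2)=\{g\in\operatorname{SL}_2(\mathbb{Z}):g\equiv I\bmod2\}$. For real $x$, $((x))=x-[x]-\tfrac12$ if $x\notin\mathbb{Z}$ and $((x))=0$ if $x\in\mathbb{Z}$; for coprime integers $c,d$ with $c\ne0$ the Dedekind sum is $s(d,c)=\sum_{k\bmod|c|}((\tfrac kc))((\tfrac{kd}{c}))$. For $g=\begin{pmatrix}a&b\\c&d\end{pmatrix}\in\operatorname{SL}_2(\mathbb{Z})$, $$\widetilde{\beta_1}(g)=\begin{cases}e^{-\pi i\frac{b}{12a}}&c=0,\\ e^{-\pi i\left[\frac{a+d}{12c}-\mathrm{sgn}(c)\,s(d,|c|)\right]}&c\ne0.\end{cases}$$ For $g=\begin{pmatrix}a&b\\c&d\end{pmatrix}\in\Gamma(2)$, $$\widetilde{\beta}(g)=\begin{cases}1&c=0,\\ \beta(d,c)=|c|^{-1/2}\sum_{n=0}^{|c|-1}e^{-\pi i dn^2/c}&c\neq0,\end{cases}$$ (both functions trivialize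 the same 2-cocycle on $\Gamma(2)$). *)

theory Defs
  imports "HOL-Analysis.Analysis" "HOL-Number_Theory.Cong"
begin

definition SL2Z :: "(int^2^2) set" where
  "SL2Z = {g. det g = 1}"

definition Gamma2 :: "(int^2^2) set" where
  "Gamma2 = {g \<in> SL2Z. \<forall>i j. [g $ i $ j = (mat 1 :: int^2^2) $ i $ j] (mod 2)}"

definition sawtooth :: "real \<Rightarrow> real" where
  "sawtooth x = (if x \<in> \<int> then 0 else x - of_int \<lfloor>x\<rfloor> - 1/2)"

text \<open>The summand depends only on the residue class of \<open>k\<close>, so the sum over
  \<open>k\<close> modulo \<open>\<bar>c\<bar>\<close> is taken over the representatives \<open>0 \<le> k < \<bar>c\<bar>\<close>.
  The definition is meant for coprime \<open>c, d\<close> with \<open>c \<noteq> 0\<close>.\<close>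

definition dedekind_sum :: "int \<Rightarrow> int \<Rightarrow> real" where
  "dedekind_sum d c =
     (\<Sum>k\<in>{0..<\<bar>c\<bar>}. sawtooth (of_int k / of_int c) * sawtooth (of_int (k * d) / of_int c))"

definition beta1_tilde :: "int^2^2 \<Rightarrow> complex" where
  "beta1_tilde g =
     (let a = g $ 1 $ 1; b = g $ 1 $ 2; c = g $ 2 $ 1; d = g $ 2 $ 2 in
      if c = 0
      then exp (- (of_real pi * \<i> * of_real (of_int b / (12 * of_int a))))
      else exp (- (of_real pi * \<i> *
             of_real (of_int (a + d) / (12 * of_int c) - of_int (sgn c) * dedekind_sum d \<bar>c\<bar>))))"

definition beta_gauss :: "int \<Rightarrow> int \<Rightarrow> complex" where
  "beta_gauss d c =
     of_real (of_int \<bar>c\<bar> powr (- 1/2)) *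
     (\<Sum>n\<in>{0..<\<bar>c\<bar>}. exp (- (of_real pi * \<i> * of_real (of_int (d * n^2) / of_int c))))"

definition beta_tilde :: "int^2^2 \<Rightarrow> complex" where
  "beta_tilde g = (if g $ 2 $ 1 = 0 then 1 else beta_gauss (g $ 2 $ 2) (g $ 2 $ 1))"

text \<open>Only the values on \<open>Gamma2\<close> are meaningful; there the denominator does not vanish
  and the values lie in the nonzero complex numbers, see \<open>chi_nonzero\<close> below.\<close>

definition chi :: "int^2^2 \<Rightarrow> complex" where
  "chi g = beta1_tilde g / beta_tilde g"

definition n2 :: "int^2^2" where
  "n2 = vector [vector [1, 2], vector [0, 1]]"

definition n2_minus :: "int^2^2" where
  "n2_minus = vector [vector [1, 0], vector [2, 1]]"


lemma Gamma2_iff: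
  "g \<in> Gamma2 \<longleftrightarrow>
     g $ 1 $ 1 * g $ 2 $ 2 - g $ 1 $ 2 * g $ 2 $ 1 = 1 \<and>
     odd (g $ 1 $ 1) \<and> even (g $ 1 $ 2) \<and> even (g $ 2 $ 1) \<and> odd (g $ 2 $ 2)"
  by (auto simp: Gamma2_def SL2Z_def det_2 forall_2 mat_def cong_def odd_iff_mod_2_eq_one
      even_iff_mod_2_eq_zero)

lemma Gamma2_uminus: "g \<in> Gamma2 \<Longrightarrow> - g \<in> Gamma2"
  by (simp add: Gamma2_iff)

lemma Gamma2_mult: "g \<in> Gamma2 \<Longrightarrow> h \<in> Gamma2 \<Longrightarrow> g ** h \<in> Gamma2"
proof -
  assume g: "g \<in> Gamma2" and h: "h \<in> Gamma2"
  then have "det (g ** h) = 1"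
    by (simp add: det_mul Gamma2_def SL2Z_def)
  with g h show ?thesis
    by (simp add: Gamma2_iff det_2) (simp add: matrix_matrix_mult_def sum_2)
qed

lemma n2_in_Gamma2: "n2 \<in> Gamma2"
  by (simp add: Gamma2_iff n2_def)

lemma n2_minus_in_Gamma2: "n2_minus \<in> Gamma2"
  by (simp add: Gamma2_iff n2_minus_def)

lemma sum_periodic_shift:
  fixes f :: "int \<Rightarrow> complex" and C m :: int
  assumes "C > 0" and per: "\<And>n. f (n mod C) = f n"
  shows "(\<Sum>n\<in>{0..<C}. f (n + m)) = (\<Sum>n\<in>{0..<C}. f n)"
proof (rule sum.reindex_bij_witness[where j = "\<lambda>n. (n + m) mod C" and i = "\<lambda>n. (n - m) mod C"])
  fix n assume "n \<in> {0..<C}"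
  then show "((n + m) mod C - m) mod C = n" "((n - m) mod C + m) mod C = n"
    by (simp_all add: mod_diff_left_eq mod_add_left_eq)
qed (use assms in auto)

lemma gauss_sum_nonzero:
  fixes c d :: int
  assumes c: "c \<noteq> 0" "even c" and cop: "coprime c d"
  shows "(\<Sum>n\<in>{0..<\<bar>c\<bar>}. exp (- (of_real pi * \<i> * of_real (of_int (d * n^2) / of_int c)))) \<noteq> (0::complex)"
proof -
  define W :: "int \<Rightarrow> complex" where
    "W x = exp (- (of_real pi * \<i> * of_real (of_int (d * x) / of_int c)))" for x
  let ?C = "\<bar>c\<bar>"
  have C: "?C > 0" using c by simp
  have add: "W (x + y) = W x * W y" for x y
    unfolding W_def exp_add[symmetric] by (simp add: algebra_simps add_divide_distrib)
  have one: "W x = 1 \<longleftrightarrow> 2 * c dvd d * x" for x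
  proof -
    have "W x = 1 \<longleftrightarrow> (\<exists>k::int. - (pi * (of_int (d * x) / of_int c)) = of_int (2 * k) * pi)"
      unfolding W_def exp_eq_1 by simp
    also have "\<dots> \<longleftrightarrow> (\<exists>k::int. real_of_int (d * x) = of_int (2 * c * (- k)))"
    proof (intro ex_cong1)
      fix k :: int
      have "- (pi * (of_int (d * x) / of_int c)) = of_int (2 * k) * pi \<longleftrightarrow>
            pi * (- (of_int (d * x) / of_int c)) = pi * of_int (2 * k)"
        by (simp add: mult.commute)
      also have "\<dots> \<longleftrightarrow> - (real_of_int (d * x) / of_int c) = of_int (2 * k)"
        by (simp only: mult_cancel_left pi_neq_zero simp_thms)
      also have "\<dots> \<longleftrightarrow> real_of_int (d * x) = of_int (2 * c * (- k))"
        using c(1) by (auto simp: field_simps)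
      finally show "- (pi * (of_int (d * x) / of_int c)) = of_int (2 * k) * pi \<longleftrightarrow>
            real_of_int (d * x) = of_int (2 * c * (- k))" .
    qed
    also have "\<dots> \<longleftrightarrow> (\<exists>k::int. d * x = 2 * c * (- k))"
      by (simp only: of_int_eq_iff)
    also have "\<dots> \<longleftrightarrow> 2 * c dvd d * x"
      unfolding dvd_def by (metis minus_minus)
    finally show ?thesis .
  qed
  have per: "W ((n mod ?C)^2) = W (n^2)" for n
  proof -
    define q where "q = n div ?C"
    have n: "n = n mod ?C + ?C * q" by (simp add: q_def)
    obtain e where e: "c = 2 * e" using c by (elim evenE)
    have "n^2 = (n mod ?C)^2 + (2 * (?C * q * (n mod ?C)) + (?C * q)^2)"
      by (subst n) (simp only: power2_sum algebra_simps)
    also have "W \<dots> = W ((n mod ?C)^2)"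
    proof -
      have "(?C * q)^2 = 2 * c * (e * q^2)" by (simp add: e power2_eq_square)
      moreover have "2 * c dvd 2 * (?C * q * (n mod ?C))"
        by (intro mult_dvd_mono) (simp_all add: dvd_mult2)
      ultimately have "2 * c dvd d * (2 * (?C * q * (n mod ?C)) + (?C * q)^2)"
        by (metis dvd_add dvd_mult dvd_triv_left)
      then have "W (2 * (?C * q * (n mod ?C)) + (?C * q)^2) = 1" by (simp only: one)
      then show ?thesis by (simp only: add[of "(n mod ?C)^2"] mult_1_right)
    qed
    finally show ?thesis by simp
  qed
  define S where "S = (\<Sum>n\<in>{0..<?C}. W (n^2))"
  have cnj: "cnj (W x) = W (- x)" for x
    unfolding W_def by (simp add: exp_cnj)
  have inner: "(\<Sum>m\<in>{0..<?C}. W (2 * k * m)) = (if k = 0 then of_int ?C else 0)"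
    if k: "k \<in> {0..<?C}" for k
  proof (cases "k = 0")
    case True then show ?thesis using one[of 0] C by simp
  next
    case False
    let ?T = "\<Sum>m\<in>{0..<?C}. W (2 * k * m)"
    have "\<not> c dvd k" using False k zdvd_not_zless[of k c] zdvd_imp_le[of "\<bar>c\<bar>" k] by auto
    then have "\<not> c dvd d * k" using cop by (simp add: coprime_dvd_mult_right_iff)
    then have "\<not> 2 * c dvd 2 * (d * k)" by simp
    then have ne: "W (2 * k) \<noteq> 1" by (simp add: one mult.left_commute)
    have p: "W (2 * k * (m mod ?C)) = W (2 * k * m)" for m
    proof -
      have "2 * k * m = 2 * k * (m mod ?C) + 2 * k * (?C * (m div ?C))"
        by (metis distrib_left mod_mult_div_eq)
      moreover have "2 * c dvd d * (2 * k * (?C * (m div ?C)))"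
      proof -
        have "d * (2 * k * (?C * (m div ?C))) = 2 * ?C * (d * k * (m div ?C))" by simp
        moreover have "2 * c dvd 2 * ?C" by simp
        ultimately show ?thesis by (metis dvd_mult2)
      qed
      ultimately show ?thesis using one add by (metis mult.right_neutral)
    qed
    have "?T = (\<Sum>m\<in>{0..<?C}. W (2 * k * (m + 1)))"
      using sum_periodic_shift[OF C, of "\<lambda>m. W (2 * k * m)" 1] p by simp
    also have "\<dots> = W (2 * k) * ?T"
      unfolding sum_distrib_left
      by (intro sum.cong refl) (simp only: distrib_left add mult_1_right mult.commute[of "W (2 * k)"])
    finally have "?T = 0" using ne by (metis mult_cancel_right2)
    then show ?thesis using False by simp
  qed
  have "S * cnj S = (\<Sum>m\<in>{0..<?C}. (\<Sum>n\<in>{0..<?C}. W (n^2)) * W (- (m^2)))"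
    unfolding S_def by (simp add: sum_distrib_left cnj)
  also have "\<dots> = (\<Sum>m\<in>{0..<?C}. (\<Sum>k\<in>{0..<?C}. W ((k + m)^2)) * W (- (m^2)))"
    using sum_periodic_shift[OF C, of "\<lambda>n. W (n^2)"] per by simp
  also have "\<dots> = (\<Sum>m\<in>{0..<?C}. \<Sum>k\<in>{0..<?C}. W (k^2) * W (2 * k * m))"
    unfolding sum_distrib_right
    by (intro sum.cong refl) (simp add: add[symmetric] power2_sum algebra_simps)
  also have "\<dots> = (\<Sum>k\<in>{0..<?C}. W (k^2) * (\<Sum>m\<in>{0..<?C}. W (2 * k * m)))"
    by (subst sum.swap) (simp add: sum_distrib_left)
  also have "\<dots> = (\<Sum>k\<in>{0..<?C}. if k = 0 then of_int ?C else 0)"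
    using one[of 0] by (intro sum.cong refl) (simp add: inner)
  also have "\<dots> = of_int ?C" using C by (simp add: sum.delta)
  finally have "S * cnj S \<noteq> 0" using C by simp
  then show ?thesis by (auto simp: S_def W_def)
qed

lemma beta_tilde_nonzero:
  assumes "g \<in> Gamma2"
  shows "beta_tilde g \<noteq> 0"
proof -
  have "coprime (g $ 2 $ 1) (g $ 2 $ 2)"
  proof (rule coprimeI)
    fix k assume "k dvd g $ 2 $ 1" "k dvd g $ 2 $ 2"
    then have "k dvd g $ 1 $ 1 * g $ 2 $ 2 - g $ 1 $ 2 * g $ 2 $ 1"
      by (simp add: dvd_diff)
    then show "is_unit k" using assms by (simp add: Gamma2_iff)
  qed
  then show ?thesis
    using assms gauss_sum_nonzero[of "g $ 2 $ 1" "g $ 2 $ 2"]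
    by (simp add: beta_tilde_def beta_gauss_def Gamma2_iff)
qed

lemma chi_nonzero: "g \<in> Gamma2 \<Longrightarrow> chi g \<noteq> 0"
  using beta_tilde_nonzero[of g] by (simp add: chi_def beta1_tilde_def Let_def)

end

theory Submission
  imports Defs "HOL-Complex_Analysis.Cauchy_Integral_Formula" "HOL-Real_Asymp.Real_Asymp"
begin

text \<open>
  Right multiplication by \<open>n2\<close> replaces \<open>d\<close> by \<open>d + 2 * c\<close>. Dedekind sums and Gauss sums of modulus
  \<open>c\<close> do not notice this, and only the term \<open>(a + d) / (12 * c)\<close> changes, by \<open>1/6\<close>. Right
  multiplication by \<open>n2_minus\<close> instead changes the modulus \<open>c\<close> to \<open>c + 2 * d\<close>, and the remedy is to
  exchange the roles of \<open>c\<close> and \<open>d\<close> by two reciprocity laws: that of Dedekind sums,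
  \<open>dedekind_sum_reciprocity\<close>, and that of quadratic Gauss sums (the Landsberg--Schaar identity),
  \<open>beta_gauss_reciprocity\<close>. Each produces the same eighth root of unity
  \<open>exp (- \<pi> \<i> sgn (c * d) / 4)\<close>, one in the numerator and one in the denominator of \<open>chi\<close>, and what
  remains, \<open>chi_reciprocal\<close>, is

  \<open>chi g = exp (- \<pi> \<i> ((b - c) / (12 * d) + sgn d * s(c, \<bar>d\<bar>))) / beta_gauss (- c) d\<close>.

  This formula holds on all of \<open>Gamma2\<close>, including \<open>c = 0\<close>, because \<open>d\<close> is odd. It makes the
  invariance under \<open>g \<mapsto> - g\<close> and the effect of \<open>c \<mapsto> c + 2 * d\<close> evident: only the linear term changes,
  by \<open>- 1/6\<close>, just as it does for \<open>n2_minus\<close> itself.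

  Dedekind reciprocity is proved by counting lattice points. The reciprocity of Gauss sums follows
  Dirichlet: a Gauss sum is the value at \<open>0\<close> of a periodized Gaussian chirp, whose Fourier series can be
  summed after completing the square.
\<close>

section \<open>Reciprocity of Dedekind sums\<close>

lemma sum_int_upto:
  fixes c :: int assumes "c \<ge> 0"
  shows "(\<Sum>k\<in>{0..<c}. real_of_int k) = of_int c * (of_int c - 1) / 2"
    and "(\<Sum>k\<in>{0..<c}. (real_of_int k)^2) = of_int c * (of_int c - 1) * (2 * of_int c - 1) / 6"
proof -
  have ins: "{0..<i + 1} = insert i {0..<i}" if "0 \<le> i" for i :: int using that by auto
  show "(\<Sum>k\<in>{0..<c}. real_of_int k) = of_int c * (of_int c - 1) / 2"
    using assms by (induction c rule: int_ge_induct) (simp_all add: ins field_simps)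
  show "(\<Sum>k\<in>{0..<c}. (real_of_int k)^2) = of_int c * (of_int c - 1) * (2 * of_int c - 1) / 6"
    using assms by (induction c rule: int_ge_induct)
      (simp_all add: ins field_simps power2_eq_square)
qed

lemma sum_mult_mod_permutes:
  fixes c d :: int and \<phi> :: "int \<Rightarrow> 'a::comm_monoid_add"
  assumes "c > 0" "coprime c d"
  shows "(\<Sum>k\<in>{0..<c}. \<phi> (k * d mod c)) = (\<Sum>k\<in>{0..<c}. \<phi> k)"
proof -
  have inj: "inj_on (\<lambda>k. k * d mod c) {0..<c}"
  proof (rule inj_onI)
    fix x y assume xy: "x \<in> {0..<c}" "y \<in> {0..<c}" "x * d mod c = y * d mod c"
    then have "[x = y] (mod c)"
      using assms(2) by (metis cong_def cong_mult_rcancel coprime_commute)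
    with xy show "x = y" by (simp add: cong_def)
  qed
  moreover have "(\<lambda>k. k * d mod c) ` {0..<c} \<subseteq> {0..<c}" using assms(1) by auto
  ultimately have "(\<lambda>k. k * d mod c) ` {0..<c} = {0..<c}"
    by (intro endo_inj_surj) auto
  with inj show ?thesis by (metis (no_types, lifting) sum.reindex_cong)
qed

text \<open>For a rational argument the sawtooth reads off the remainder of an integer division, which
  makes Dedekind sums accessible to integer arithmetic.\<close>

lemma sawtooth_of_int_divide:
  fixes m c :: int assumes "c > 0"
  shows "sawtooth (of_int m / of_int c) = (if c dvd m then 0 else of_int (m mod c) / of_int c - 1/2)"
proof -
  have "real_of_int m / of_int c \<in> \<int> \<longleftrightarrow> c dvd m"
  proof
    assume "real_of_int m / of_int c \<in> \<int>"
    then obtain k where "real_of_int m / of_int c = of_int k" by (elim Ints_cases)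
    then have "real_of_int m = of_int (c * k)" using assms by (simp add: field_simps)
    then show "c dvd m" by (metis dvd_triv_left of_int_eq_iff)
  next
    assume "c dvd m"
    then show "real_of_int m / of_int c \<in> \<int>" using assms by (auto elim!: dvdE)
  qed
  moreover have "real_of_int m = of_int c * of_int (m div c) + of_int (m mod c)"
    by (metis mult_div_mod_eq of_int_add of_int_mult)
  then have "real_of_int m / of_int c - of_int (m div c) = of_int (m mod c) / of_int c"
    using assms by (simp add: field_simps)
  ultimately show ?thesis
    by (simp add: sawtooth_def floor_divide_of_int_eq)
qed

text \<open>Off \<open>k = 0\<close> both factors are of the form remainder \<open>/ c - 1/2\<close>; the term \<open>k = 0\<close>, if treated
  in the same way, would contribute \<open>1/4\<close>. After expanding the product, the linear sums are known
  because multiplication by \<open>d\<close> permutes the residues.\<close>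

lemma dedekind_sum_alt:
  fixes c d :: int
  assumes c: "c > 0" and cop: "coprime c d"
  shows "dedekind_sum d c =
    (\<Sum>k\<in>{0..<c}. real_of_int k * of_int (k * d mod c)) / (of_int c)^2 - (of_int c - 1) / 4"
proof -
  let ?r = "\<lambda>k. real_of_int (k * d mod c)" and ?c = "real_of_int c"
    and ?S = "\<Sum>k\<in>{0..<c}. real_of_int k"
  have "sawtooth (of_int k / of_int c) * sawtooth (of_int (k * d) / of_int c) =
        (of_int k / ?c - 1/2) * (?r k / ?c - 1/2) - (if k = 0 then 1/4 else 0)"
    if k: "k \<in> {0..<c}" for k
  proof (cases "k = 0")
    case True then show ?thesis by (simp add: sawtooth_def)
  next
    case False
    then have "\<not> c dvd k" using k zdvd_not_zless[of k c] by auto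
    moreover then have "\<not> c dvd k * d" using cop by (simp add: coprime_dvd_mult_left_iff)
    ultimately show ?thesis using False k by (simp only: sawtooth_of_int_divide[OF c]) simp
  qed
  then have "dedekind_sum d c =
     (\<Sum>k\<in>{0..<c}. (of_int k / ?c - 1/2) * (?r k / ?c - 1/2) - (if k = 0 then 1/4 else 0))"
    unfolding dedekind_sum_def using c by (intro sum.cong) auto
  also have "\<dots> = (\<Sum>k\<in>{0..<c}. (of_int k * ?r k / ?c^2 - of_int k / (2 * ?c) - ?r k / (2 * ?c) + 1/4)
      - (if k = 0 then 1/4 else 0))"
    using c by (intro sum.cong refl) (simp add: field_simps power2_eq_square)
  also have "\<dots> = (\<Sum>k\<in>{0..<c}. of_int k * ?r k) / ?c^2 - (\<Sum>k\<in>{0..<c}. of_int k) / (2 * ?c)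
      - (\<Sum>k\<in>{0..<c}. ?r k) / (2 * ?c) + ?c / 4 - 1/4"
    using c by (simp add: sum.distrib sum_subtractf sum_divide_distrib sum.delta)
  also have "(\<Sum>k\<in>{0..<c}. ?r k) = (\<Sum>k\<in>{0..<c}. of_int k)"
    by (rule sum_mult_mod_permutes[OF c cop])
  also have "X - ?S / (2 * ?c) - ?S / (2 * ?c) + ?c / 4 - 1/4 = X - (?c - 1) / 4" for X
    using c by (simp add: sum_int_upto field_simps)
  finally show ?thesis .
qed

lemma sum_div_coprime:
  fixes c d :: int
  assumes c: "c > 0" and cop: "coprime c d"
  shows "(\<Sum>k\<in>{0..<c}. real_of_int (k * d div c)) = (of_int c - 1) * (of_int d - 1) / 2"
proof -
  have "real_of_int (k * d div c) = (of_int k * of_int d - of_int (k * d mod c)) / of_int c" for k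
  proof -
    have "real_of_int k * of_int d = of_int c * of_int (k * d div c) + of_int (k * d mod c)"
      by (metis mult_div_mod_eq of_int_add of_int_mult)
    then show ?thesis using c by (simp add: field_simps)
  qed
  then have "(\<Sum>k\<in>{0..<c}. real_of_int (k * d div c)) =
     ((\<Sum>k\<in>{0..<c}. real_of_int k) * of_int d - (\<Sum>k\<in>{0..<c}. real_of_int (k * d mod c))) / of_int c"
    by (simp add: sum_divide_distrib[symmetric] sum_subtractf sum_distrib_right)
  also have "(\<Sum>k\<in>{0..<c}. real_of_int (k * d mod c)) = (\<Sum>k\<in>{0..<c}. real_of_int k)"
    by (rule sum_mult_mod_permutes[OF c cop])
  also have "((\<Sum>k\<in>{0..<c}. real_of_int k) * of_int d - (\<Sum>k\<in>{0..<c}. real_of_int k)) / of_int c =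
      (of_int c - 1) * (of_int d - 1) / 2"
    using c by (simp add: sum_int_upto field_simps)
  finally show ?thesis .
qed

lemma int_div_less_iff:
  fixes a b c :: int assumes "c > 0"
  shows "a div c < b \<longleftrightarrow> a < b * c"
  using pos_imp_zdiv_neg_iff[OF assms, of "a - b * c"] assms
    div_mult_self1[of c a "- b"] by simp

text \<open>Since \<open>q^2\<close> is the sum of the first \<open>q\<close> odd numbers, the left-hand sum of squares is a
  weighted count of the lattice points \<open>(k, j)\<close> under the diagonal of a \<open>c\<close> by \<open>d\<close> rectangle, the
  weight being \<open>2 * j - 1\<close>. Coprimality keeps lattice points off the diagonal, so counting by
  rows \<open>j\<close> instead gives the complement of \<open>j * c div d\<close> in each row.\<close>

lemma sum_square_div_lattice:
  fixes c d :: int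
  assumes c: "c > 0" and d: "d > 0" and cop: "coprime c d"
  shows "(\<Sum>k\<in>{0..<c}. (real_of_int (k * d div c))^2) +
         2 * (\<Sum>j\<in>{0..<d}. real_of_int j * of_int (j * c div d)) =
         (of_int c - 1) * (of_int d - 1)^2 + (of_int c - 1) * (of_int d - 1) / 2"
proof -
  let ?c = "real_of_int c" and ?d = "real_of_int d" and ?p = "\<lambda>j. real_of_int (j * c div d)"
  have odds: "(\<Sum>j\<in>{1..<n + 1}. 2 * real_of_int j - 1) = (of_int n)^2" if "n \<ge> 0" for n :: int
  proof -
    have ins: "{1..<i + 2} = insert (i + 1) {1..<i + 1}" if "0 \<le> i" for i :: int using that by auto
    show ?thesis using that
      by (induction n rule: int_ge_induct) (simp_all add: ins power2_eq_square algebra_simps)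
  qed
  have row: "(real_of_int (k * d div c))^2 =
      (\<Sum>j\<in>{1..<d}. if j * c \<le> k * d then 2 * real_of_int j - 1 else 0)" if k: "k \<in> {0..<c}" for k
  proof -
    have "k * d < d * c" using k d by (simp add: mult.commute)
    then have less: "k * d div c < d" using c by (simp add: int_div_less_iff)
    have iff: "j * c \<le> k * d \<longleftrightarrow> j \<le> k * d div c" for j
      using int_div_less_iff[OF c, of "k * d" j] by (cases "k * d div c < j") auto
    have "{1..<k * d div c + 1} = {j \<in> {1..<d}. j * c \<le> k * d}"
      unfolding iff using less by auto
    moreover have "0 \<le> k * d div c" using k c d by (simp add: pos_imp_zdiv_nonneg_iff)
    ultimately show ?thesis
      using odds[of "k * d div c"] by (simp only: sum.inter_filter[OF finite_atLeastLessThan_int])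
  qed
  have col: "(\<Sum>k\<in>{0..<c}. if j * c \<le> k * d then 2 * real_of_int j - 1 else 0) =
      (2 * of_int j - 1) * (?c - 1 - ?p j)" if j: "j \<in> {1..<d}" for j
  proof -
    have "\<not> d dvd j" using j zdvd_not_zless[of j d] by auto
    then have nd: "\<not> d dvd j * c" using cop by (simp add: coprime_commute coprime_dvd_mult_left_iff)
    have iff: "j * c \<le> k * d \<longleftrightarrow> j * c div d < k" for k
    proof -
      have "j * c \<noteq> k * d" using nd by auto
      then have "j * c \<le> k * d \<longleftrightarrow> j * c < k * d" by linarith
      then show ?thesis using d by (simp add: int_div_less_iff)
    qed
    have p: "0 \<le> j * c div d" "j * c div d < c"
      using j c d by (simp_all add: pos_imp_zdiv_nonneg_iff int_div_less_iff mult.commute)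
    have "{k \<in> {0..<c}. j * c \<le> k * d} = {j * c div d + 1..<c}"
      unfolding iff using p by auto
    moreover have "real (card {j * c div d + 1..<c}) = ?c - 1 - ?p j"
      using p by (simp add: of_nat_nat)
    ultimately show ?thesis
      by (simp add: sum.inter_filter[OF finite_atLeastLessThan_int, symmetric])
  qed
  have zero: "{0..<d} = insert 0 {1..<d}" using d by auto
  have "(\<Sum>k\<in>{0..<c}. (real_of_int (k * d div c))^2) =
     (\<Sum>k\<in>{0..<c}. \<Sum>j\<in>{1..<d}. if j * c \<le> k * d then 2 * real_of_int j - 1 else 0)"
    by (intro sum.cong refl row)
  also have "\<dots> = (\<Sum>j\<in>{1..<d}. (2 * of_int j - 1) * (?c - 1 - ?p j))"
    by (subst sum.swap) (intro sum.cong refl col)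
  also have "\<dots> = (\<Sum>j\<in>{0..<d}. (2 * of_int j - 1) * (?c - 1 - ?p j)) + (?c - 1)"
    by (simp add: zero)
  also have "(\<Sum>j\<in>{0..<d}. (2 * of_int j - 1) * (?c - 1 - ?p j)) =
     2 * (?c - 1) * (\<Sum>j\<in>{0..<d}. of_int j) - ?d * (?c - 1) - 2 * (\<Sum>j\<in>{0..<d}. of_int j * ?p j)
     + (\<Sum>j\<in>{0..<d}. ?p j)"
    using d by (simp add: algebra_simps sum.distrib sum_subtractf sum_distrib_left)
  also have "(\<Sum>j\<in>{0..<d}. ?p j) = (?d - 1) * (?c - 1) / 2"
    using sum_div_coprime[OF d, of c] cop by (simp add: coprime_commute)
  finally show ?thesis
    using d by (simp add: sum_int_upto power2_eq_square field_simps)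
qed

text \<open>With \<open>k * d = c * q + r\<close>, comparing \<open>\<Sum>r^2 = \<Sum>k^2\<close> expresses \<open>\<Sum>k * q\<close>, hence the first
  Dedekind sum, through \<open>\<Sum>q^2\<close>; the lattice count relates \<open>\<Sum>q^2\<close> to the sum \<open>\<Sum>j * p\<close> that
  determines the second.\<close>

lemma dedekind_sum_reciprocity:
  fixes c d :: int
  assumes c: "c > 0" and d: "d > 0" and cop: "coprime c d"
  shows "dedekind_sum d c + dedekind_sum c d =
    - 1/4 + (of_int d / of_int c + of_int c / of_int d + 1 / (of_int c * of_int d)) / 12"
proof -
  let ?c = "real_of_int c" and ?d = "real_of_int d"
  define X where "X = (\<Sum>k\<in>{0..<c}. real_of_int k * of_int (k * d div c))"
  define Y where "Y = (\<Sum>j\<in>{0..<d}. real_of_int j * of_int (j * c div d))"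
  define Q where "Q = (\<Sum>k\<in>{0..<c}. (real_of_int (k * d div c))^2)"
  define S where "S m = (\<Sum>k\<in>{0..<m}. (real_of_int k)^2)" for m
  have md: "real_of_int (k * m mod n) = of_int k * of_int m - of_int n * of_int (k * m div n)" for k m n :: int
    by (metis minus_mult_div_eq_mod of_int_diff of_int_mult)
  have 1: "dedekind_sum d c = (?d * S c - ?c * X) / ?c^2 - (?c - 1) / 4"
    unfolding dedekind_sum_alt[OF c cop] md S_def X_def
    by (simp add: algebra_simps sum_subtractf sum_distrib_left power2_eq_square)
  have 2: "dedekind_sum c d = (?c * S d - ?d * Y) / ?d^2 - (?d - 1) / 4"
    unfolding dedekind_sum_alt[OF d coprime_commute[THEN iffD1, OF cop]] md S_def Y_def
    by (simp add: algebra_simps sum_subtractf sum_distrib_left power2_eq_square)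
  have "S c = (\<Sum>k\<in>{0..<c}. (real_of_int (k * d mod c))^2)"
    unfolding S_def by (rule sum_mult_mod_permutes[OF c cop, symmetric])
  also have "\<dots> = ?d^2 * S c - 2 * ?c * ?d * X + ?c^2 * Q"
    unfolding md S_def X_def Q_def
    by (simp add: power2_eq_square algebra_simps sum_subtractf sum.distrib sum_distrib_left)
  finally have 3: "X = ((?d^2 - 1) * S c + ?c^2 * Q) / (2 * ?c * ?d)"
    using c d by (simp add: field_simps)
  have 4: "Q = (?c - 1) * (?d - 1)^2 + (?c - 1) * (?d - 1) / 2 - 2 * Y"
    using sum_square_div_lattice[OF assms] by (simp add: Q_def Y_def)
  have S: "S c = ?c * (?c - 1) * (2 * ?c - 1) / 6" "S d = ?d * (?d - 1) * (2 * ?d - 1) / 6"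
    using c d by (simp_all add: S_def sum_int_upto)
  show ?thesis
    unfolding 1 2 3 4 S using c d by (simp add: field_simps power2_eq_square power3_eq_cube)
qed

section \<open>Pointwise convergence of a Fourier series\<close>

text \<open>Integration by parts gains a factor \<open>1 / w\<close>.\<close>

lemma riemann_lebesgue_C1:
  fixes h h' :: "real \<Rightarrow> complex"
  assumes h: "\<And>t. t \<in> {0..1} \<Longrightarrow> (h has_vector_derivative h' t) (at t within {0..1})"
    and h': "continuous_on {0..1} h'"
  obtains C where "\<And>w. w \<noteq> 0 \<Longrightarrow> norm (integral {0..1} (\<lambda>t. h t * exp (\<i> * of_real (w * t)))) \<le> C / \<bar>w\<bar>"
proof -
  have conth: "continuous_on {0..1} h"
    using h by (meson continuous_on_vector_derivative)
  obtain M where M: "\<And>t. t \<in> {0..1} \<Longrightarrow> norm (h' t) \<le> M"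
    using compact_imp_bounded[OF compact_continuous_image[OF h' compact_Icc]]
    unfolding bounded_iff by blast
  have "norm (integral {0..1} (\<lambda>t. h t * exp (\<i> * of_real (w * t)))) \<le> (norm (h 1) + norm (h 0) + M) / \<bar>w\<bar>"
    if w: "w \<noteq> 0" for w
  proof -
    define e where "e t = exp (\<i> * of_real w * of_real t)" for t
    have e_alt: "e t = exp (\<i> * of_real (w * t))" for t by (simp add: e_def mult.assoc)
    have ne: "norm (e t) = 1" for t by (simp add: e_alt)
    have e': "(e has_vector_derivative \<i> * of_real w * e t) (at t within {0..1})" for t
      unfolding e_def
      by (rule has_vector_derivative_real_field) (auto intro!: derivative_eq_intros)
    have conte: "continuous_on {0..1} e" unfolding e_def by (intro continuous_intros)
    have i1: "(\<lambda>t. h t * e t) integrable_on {0..1}"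
      and i2: "(\<lambda>t. h' t * e t) integrable_on {0..1}"
      by (intro integrable_continuous_interval continuous_intros conth conte h')+
    have "((\<lambda>t. h t * (\<i> * of_real w * e t) + h' t * e t) has_integral (h 1 * e 1 - h 0 * e 0)) {0..1}"
      by (rule fundamental_theorem_of_calculus) (auto intro!: has_vector_derivative_mult h e')
    moreover have "((\<lambda>t. h t * (\<i> * of_real w * e t) + h' t * e t) has_integral
        (\<i> * of_real w * integral {0..1} (\<lambda>t. h t * e t) + integral {0..1} (\<lambda>t. h' t * e t))) {0..1}"
      using has_integral_add[OF has_integral_mult_right[OF integrable_integral[OF i1], of "\<i> * of_real w"]
          integrable_integral[OF i2]]
      by (simp add: mult_ac)
    ultimately have "\<i> * of_real w * integral {0..1} (\<lambda>t. h t * e t) =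
        h 1 * e 1 - h 0 * e 0 - integral {0..1} (\<lambda>t. h' t * e t)"
      by (metis (no_types, lifting) add_diff_cancel_right' has_integral_unique)
    then have "\<bar>w\<bar> * norm (integral {0..1} (\<lambda>t. h t * e t)) =
        norm (h 1 * e 1 - h 0 * e 0 - integral {0..1} (\<lambda>t. h' t * e t))"
      by (metis norm_mult norm_of_real norm_ii mult_1)
    also have "\<dots> \<le> norm (h 1 * e 1) + norm (h 0 * e 0) + norm (integral {0..1} (\<lambda>t. h' t * e t))"
      by (intro norm_triangle_le_diff add_right_mono norm_triangle_ineq4)
    also have "norm (integral {0..1} (\<lambda>t. h' t * e t)) \<le> M * (1 - 0)"
      using M by (intro integral_bound continuous_intros h' conte) (auto simp: norm_mult ne)
    finally show ?thesis using w by (simp add: norm_mult ne field_simps e_alt)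
  qed
  then show thesis by (rule that)
qed

lemma entire_factor:
  assumes "G holomorphic_on UNIV" "G a = 0"
  obtains A where "A holomorphic_on UNIV" "\<And>z. G z = (z - a) * A z"
proof
  let ?A = "\<lambda>z. if z = a then deriv G a else (G z - G a) / (z - a)"
  show "?A holomorphic_on UNIV" using assms(1) by (intro pole_lemma_open) auto
  show "G z = (z - a) * ?A z" for z using assms(2) by simp
qed

text \<open>Pointwise convergence of the Fourier series at the endpoint. The partial sum of the
  exponentials is geometric with denominator \<open>1 - exp (- 2 \<pi> \<i> t)\<close>, which vanishes to first order at
  \<open>0\<close> and \<open>1\<close> only; so does \<open>F - F 0\<close>. The quotient is therefore holomorphic along \<open>[0, 1]\<close>, and the
  error consists of two of its Fourier coefficients, which decay. The range of summation is
  half-open so that its length \<open>2 * K\<close> can later be made a multiple of a period.\<close>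

lemma fourier_sum_tendsto:
  fixes F :: "complex \<Rightarrow> complex"
  assumes hol: "F holomorphic_on UNIV" and per: "F 0 = F 1"
  shows "(\<lambda>K::nat. \<Sum>k\<in>{- int K..<int K}.
           integral {0..1} (\<lambda>t. F (of_real t) * exp (- (2 * of_real pi * \<i> * of_int k * of_real t)))) \<longlonglongrightarrow> F 0"
proof -
  define N where "N z = 1 - exp (- (2 * of_real pi * \<i> * z))" for z :: complex
  have holN: "N holomorphic_on UNIV" unfolding N_def by (intro holomorphic_intros)
  have fact2: "\<exists>A. A holomorphic_on UNIV \<and> (\<forall>z. G z = z * (z - 1) * A z)"
    if G: "G holomorphic_on UNIV" "G 0 = 0" "G 1 = 0" for G :: "complex \<Rightarrow> complex"
  proof -
    obtain B where B: "B holomorphic_on UNIV" "\<And>z. G z = (z - 0) * B z"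
      using entire_factor[OF G(1,2)] by blast
    then have "B 1 = 0" using G(3) by simp
    from entire_factor[OF B(1) this] B(2) show ?thesis by (metis diff_zero mult.assoc)
  qed
  obtain A where A: "A holomorphic_on UNIV" "\<And>z. F z - F 0 = z * (z - 1) * A z"
  proof -
    have "(\<lambda>z. F z - F 0) holomorphic_on UNIV" by (intro holomorphic_intros hol)
    from fact2[OF this] per that show thesis by auto
  qed
  have "N 0 = 0" "N 1 = 0" by (simp_all add: N_def exp_minus)
  then obtain B where B: "B holomorphic_on UNIV" "\<And>z. N z = z * (z - 1) * B z"
    using fact2[OF holN] by blast
  have N': "(N has_field_derivative 2 * of_real pi * \<i> * exp (- (2 * of_real pi * \<i> * z))) (at z)" for z
    unfolding N_def by (auto intro!: derivative_eq_intros)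
  have Bd: "(B has_field_derivative deriv B z) (at z)" for z
    using B(1) by (simp add: holomorphic_derivI)
  have N'': "(N has_field_derivative (2 * z - 1) * B z + z * (z - 1) * deriv B z) (at z)" for z
    unfolding B(2) by (rule derivative_eq_intros Bd refl | simp add: algebra_simps)+
  \<comment> \<open>At the endpoints \<open>B\<close> is, up to sign, the nonzero derivative of \<open>N\<close>.\<close>
  have Bz: "B (of_real t) \<noteq> 0" if t: "t \<in> {0..1}" for t
  proof (cases "t = 0 \<or> t = 1")
    case True
    then show ?thesis using DERIV_unique[OF N' N'', of "of_real t"] by auto
  next
    case False
    have "N (of_real t) \<noteq> 0"
    proof
      assume "N (of_real t) = 0"
      then have "exp (- (2 * of_real pi * \<i> * of_real t)) = 1" by (simp add: N_def)
      then obtain n :: int where "- (2 * pi * t) = of_int (2 * n) * pi"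
        by (auto simp: exp_eq_1)
      then have "pi * t = pi * of_int (- n)" by simp
      then have "t = of_int (- n)" by (simp only: mult_cancel_left pi_neq_zero simp_thms)
      then have "t = of_int (- n)" "0 \<le> - n" "- n \<le> 1" using t by auto
      then have "- n = 0 \<or> - n = 1" by linarith
      then show False using \<open>t = of_int (- n)\<close> False by auto
    qed
    then show ?thesis by (auto simp: B(2))
  qed
  define h where "h z = A z / B z" for z
  have Ad: "(A has_field_derivative deriv A z) (at z)" for z
    using A(1) by (simp add: holomorphic_derivI)
  define h' where "h' z = (deriv A z * B z - A z * deriv B z) / (B z * B z)" for z
  have hd: "((\<lambda>t. h (of_real t)) has_vector_derivative h' (of_real t)) (at t within {0..1})"
    if "t \<in> {0..1}" for t
    unfolding h_def h'_def using Bz[OF that]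
    by (intro has_vector_derivative_real_field DERIV_divide Ad Bd) 
  have conts: "continuous_on {0..1} (\<lambda>t::real. G (of_real t))" if "G holomorphic_on UNIV" for G :: "complex \<Rightarrow> complex"
    using holomorphic_on_imp_continuous_on[OF that]
    by (rule continuous_on_compose2) (auto intro: continuous_intros)
  have "continuous_on {0..1} (\<lambda>t. h' (of_real t))"
    unfolding h'_def using Bz A(1) B(1)
    by (intro continuous_intros conts holomorphic_deriv) auto
  then obtain C where C: "\<And>w. w \<noteq> 0 \<Longrightarrow>
     norm (integral {0..1} (\<lambda>t. h (of_real t) * exp (\<i> * of_real (w * t)))) \<le> C / \<bar>w\<bar>"
    using riemann_lebesgue_C1[OF hd] by blast
  define e where "e k t = exp (- (2 * of_real pi * \<i> * of_int k * of_real t))" for k :: int and t :: real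
  have e_has: "(e k has_integral (if k = 0 then 1 else 0)) {0..1}" for k
  proof (cases "k = 0")
    case True then show ?thesis using has_integral_const_real[of "1::complex" 0 1] by (simp add: e_def[abs_def])
  next
    case False
    let ?c = "- (2 * of_real pi * \<i> * of_int k) :: complex"
    have "(e k has_integral (exp (?c * of_real 1) / ?c - exp (?c * of_real 0) / ?c)) {0..1}"
      unfolding e_def
      by (rule fundamental_theorem_of_calculus)
        (use False in \<open>auto intro!: derivative_eq_intros has_vector_derivative_real_field\<close>)
    moreover have "exp ?c = 1"
      unfolding exp_eq_1 by (auto intro!: exI[of _ "- k"])
    ultimately show ?thesis using False by simp
  qed
  have geo: "N (of_real t) * (\<Sum>k\<in>{- int K..<int K}. e k t) = e (- int K) t - e (int K) t" for K :: nat and t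
  proof -
    have "N (of_real t) * (\<Sum>k\<in>{a..<b}. e k t) = e a t - e b t" if "a \<le> b" for a b
      using that
    proof (induction b rule: int_ge_induct)
      case (step b)
      have ins: "{a..<b + 1} = insert b {a..<b}" using step by auto
      have "e (b + 1) t = e b t * e 1 t"
        by (simp add: e_def exp_add[symmetric] algebra_simps)
      moreover have "N (of_real t) * e b t = e b t - e b t * e 1 t"
        by (simp add: N_def e_def algebra_simps)
      ultimately show ?case by (simp add: ins distrib_left step.IH)
    qed simp
    then show ?thesis by simp
  qed
  have FB: "(\<lambda>t. F (of_real t) * e k t) integrable_on {0..1}" for k
    unfolding e_def by (intro integrable_continuous_interval continuous_intros conts hol)
  have conth: "continuous_on {0..1} (\<lambda>t. h (of_real t))"
    using hd by (meson continuous_on_vector_derivative)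
  have hi: "(\<lambda>t. h (of_real t) * e k t) integrable_on {0..1}" for k
    unfolding e_def by (intro integrable_continuous_interval continuous_intros conth)
  let ?I = "\<lambda>k. integral {0..1} (\<lambda>t. h (of_real t) * e k t)"
  have main: "(\<Sum>k\<in>{- int K..<int K}. integral {0..1} (\<lambda>t. F (of_real t) * e k t)) - F 0
      = ?I (- int K) - ?I (int K)" if K: "K > 0" for K
  proof -
    have "((\<lambda>t. \<Sum>k\<in>{- int K..<int K}. (F (of_real t) - F 0) * e k t) has_integral
        (\<Sum>k\<in>{- int K..<int K}. integral {0..1} (\<lambda>t. F (of_real t) * e k t) - F 0 * (if k = 0 then 1 else 0))) {0..1}"
      unfolding left_diff_distrib
      by (intro has_integral_sum has_integral_diff integrable_integral FB has_integral_mult_right e_has) auto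
    also have "(\<Sum>k\<in>{- int K..<int K}. integral {0..1} (\<lambda>t. F (of_real t) * e k t) - F 0 * (if k = 0 then 1 else 0))
       = (\<Sum>k\<in>{- int K..<int K}. integral {0..1} (\<lambda>t. F (of_real t) * e k t)) - F 0"
      using K by (simp add: sum_subtractf sum.delta if_distrib[of "\<lambda>x. F 0 * x"] cong: if_cong)
    also have "(\<lambda>t. \<Sum>k\<in>{- int K..<int K}. (F (of_real t) - F 0) * e k t) =
        (\<lambda>t. \<Sum>k\<in>{- int K..<int K}. (of_real t * (of_real t - 1) * A (of_real t)) * e k t)"
      by (simp only: A(2))
    finally have 1: "((\<lambda>t. \<Sum>k\<in>{- int K..<int K}. (of_real t * (of_real t - 1) * A (of_real t)) * e k t) has_integral
       (\<Sum>k\<in>{- int K..<int K}. integral {0..1} (\<lambda>t. F (of_real t) * e k t)) - F 0) {0..1}" .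
    have 2: "((\<lambda>t. h (of_real t) * e (- int K) t - h (of_real t) * e (int K) t) has_integral
       (?I (- int K) - ?I (int K))) {0..1}"
      by (intro has_integral_diff integrable_integral hi)
    have "(\<Sum>k\<in>{- int K..<int K}. (of_real t * (of_real t - 1) * A (of_real t)) * e k t) =
       h (of_real t) * e (- int K) t - h (of_real t) * e (int K) t" if "t \<in> {0..1}" for t
    proof -
      have "(\<Sum>k\<in>{- int K..<int K}. (of_real t * (of_real t - 1) * A (of_real t)) * e k t) =
         h (of_real t) * (N (of_real t) * (\<Sum>k\<in>{- int K..<int K}. e k t))"
        using Bz[OF that] by (simp add: h_def B(2) sum_distrib_left mult_ac)
      then show ?thesis unfolding geo by (simp add: algebra_simps)
    qed
    then have "((\<lambda>t. h (of_real t) * e (- int K) t - h (of_real t) * e (int K) t) has_integral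
      (\<Sum>k\<in>{- int K..<int K}. integral {0..1} (\<lambda>t. F (of_real t) * e k t)) - F 0) {0..1}"
      by (rule has_integral_eq[OF _ 1])
    with 2 show ?thesis using has_integral_unique by blast
  qed
  have I: "norm (?I k) \<le> (C / (2 * pi)) / \<bar>of_int k\<bar>" if "k \<noteq> 0" for k
    using C[of "- (2 * pi * of_int k)"] that by (simp add: e_def mult_ac abs_mult)
  have "(\<lambda>K. ((\<Sum>k\<in>{- int K..<int K}. integral {0..1} (\<lambda>t. F (of_real t) * e k t)) - F 0)) \<longlonglongrightarrow> 0"
  proof (rule Lim_null_comparison)
    show "\<forall>\<^sub>F K in sequentially. norm ((\<Sum>k\<in>{- int K..<int K}. integral {0..1} (\<lambda>t. F (of_real t) * e k t)) - F 0)
        \<le> (C / pi) / of_nat K"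
    proof (rule eventually_mono[OF eventually_gt_at_top[of 0]])
      fix K :: nat assume K: "K > 0"
      have "norm (?I (- int K) - ?I (int K)) \<le> C / (2 * pi) / of_nat K + C / (2 * pi) / of_nat K"
        using I[of "- int K"] I[of "int K"] K by (intro norm_triangle_le_diff) auto
      then show "norm ((\<Sum>k\<in>{- int K..<int K}. integral {0..1} (\<lambda>t. F (of_real t) * e k t)) - F 0)
        \<le> (C / pi) / of_nat K" unfolding main[OF K] by simp
    qed
    show "(\<lambda>K. (C / pi) / of_nat K) \<longlonglongrightarrow> 0" by (rule lim_const_over_n)
  qed
  then show ?thesis unfolding e_def by (simp add: LIM_zero_iff)
qed

section \<open>Reciprocity of quadratic Gauss sums\<close>

text \<open>The Fresnel integral converges at infinity: subtracting the leading term
  \<open>exp (- \<pi> \<i> x^2) / (- 2 \<pi> \<i> x)\<close> of its asymptotic expansion leaves a function whose derivative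
  is \<open>O(1 / x^2)\<close>. The value of the limit is found later from a special Gauss sum.\<close>

lemma fresnel_primitive:
  obtains E :: "complex \<Rightarrow> complex" and L :: complex
  where "\<And>z. (E has_field_derivative exp (- (of_real pi * \<i> * z^2))) (at z)"
    and "\<And>z. E (- z) = - E z"
    and "((\<lambda>x. E (of_real x)) \<longlongrightarrow> L) at_top"
proof -
  have "(\<lambda>z. exp (- (of_real pi * \<i> * z^2))) holomorphic_on UNIV"
    by (intro holomorphic_intros)
  then obtain G where G: "\<And>z. (G has_field_derivative exp (- (of_real pi * \<i> * z^2))) (at z)"
    by (rule holomorphic_convex_primitive'[OF convex_UNIV open_UNIV]) auto
  \<comment> \<open>Antisymmetrizing keeps the derivative, which is even.\<close>
  define E where "E z = (G z - G (- z)) / 2" for z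
  have E: "(E has_field_derivative exp (- (of_real pi * \<i> * z^2))) (at z)" for z
  proof -
    have "((\<lambda>z. G (- z)) has_field_derivative exp (- (of_real pi * \<i> * (- z)^2)) * (- 1)) (at z)"
      by (rule DERIV_chain2[OF G]) (auto intro!: derivative_eq_intros)
    from DERIV_cdivide[OF DERIV_diff[OF G this], of 2] show ?thesis
      unfolding E_def by simp
  qed
  define w where "w x = E (of_real x) + exp (- (of_real pi * \<i> * (of_real x)^2)) / (2 * of_real pi * \<i> * of_real x)" for x :: real
  have w': "(w has_vector_derivative - exp (- (of_real pi * \<i> * (of_real x)^2)) / (2 * of_real pi * \<i> * (of_real x)^2)) (at x)"
    if "x > 0" for x :: real
    unfolding w_def using that
    by (intro has_vector_derivative_real_field)
      (auto intro!: derivative_eq_intros E simp: field_simps power2_eq_square)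
  have wbound: "norm (w y - w x) \<le> 1 / (2 * pi * x)" if xy: "0 < x" "x < y" for x y
  proof -
    have "norm (w y - w x) \<le> (- 1 / (2 * pi * y)) - (- 1 / (2 * pi * x))"
    proof (rule differentiable_bound_general[OF xy(2)])
      show "continuous_on {x..y} w"
        using w' xy by (intro continuous_at_imp_continuous_on ballI)
          (auto intro!: has_vector_derivative_continuous[OF w'])
      show "continuous_on {x..y} (\<lambda>t. - 1 / (2 * pi * t))"
        using xy by (intro continuous_intros) auto
      fix t assume t: "x < t" "t < y"
      then show "(w has_vector_derivative - exp (- (of_real pi * \<i> * (of_real t)^2)) / (2 * of_real pi * \<i> * (of_real t)^2)) (at t)"
        using xy by (intro w') auto
      show "((\<lambda>t. - 1 / (2 * pi * t)) has_vector_derivative 1 / (2 * pi * t^2)) (at t)"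
        using t xy unfolding has_real_derivative_iff_has_vector_derivative[symmetric]
        by (auto intro!: derivative_eq_intros simp: field_simps power2_eq_square)
      show "norm (- exp (- (of_real pi * \<i> * (of_real t)^2)) / (2 * of_real pi * \<i> * (of_real t)^2)) \<le> 1 / (2 * pi * t^2)"
        by (simp add: norm_divide norm_mult norm_power)
    qed
    also have "\<dots> \<le> 1 / (2 * pi * x)" using xy by simp
    finally show ?thesis .
  qed
  have "Cauchy (\<lambda>n. w (of_nat (Suc n)))"
  proof (rule CauchyI')
    fix e :: real assume e: "e > 0"
    obtain M :: nat where M: "1 / (2 * pi * e) < of_nat M" using reals_Archimedean2 by blast
    show "\<exists>M. \<forall>m\<ge>M. \<forall>n>m. dist (w (of_nat (Suc m))) (w (of_nat (Suc n))) < e"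
      unfolding dist_norm
    proof (intro exI[of _ M] allI impI)
      fix m n assume mn: "M \<le> m" "m < n"
      have "norm (w (of_nat (Suc m)) - w (of_nat (Suc n))) \<le> 1 / (2 * pi * of_nat (Suc m))"
        using wbound[of "of_nat (Suc m)" "of_nat (Suc n)"] mn by (simp add: norm_minus_commute)
      also have "\<dots> < e"
      proof -
        have "1 / (2 * pi * e) < of_nat (Suc m)" using M mn by linarith
        then show ?thesis using e by (simp add: field_simps del: of_nat_Suc)
      qed
      finally show "norm (w (of_nat (Suc m)) - w (of_nat (Suc n))) < e" .
    qed
  qed
  then obtain L where L: "(\<lambda>n. w (of_nat (Suc n))) \<longlonglongrightarrow> L"
    using Cauchy_convergent_iff convergent_def by blast
  have wL: "norm (w x - L) \<le> 1 / (2 * pi * x)" if x: "x > 0" for x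
  proof -
    obtain M :: nat where M: "x < of_nat M" using reals_Archimedean2 by blast
    show ?thesis
    proof (rule Lim_bounded)
      show "(\<lambda>n. norm (w x - w (of_nat (Suc n)))) \<longlonglongrightarrow> norm (w x - L)"
        by (intro tendsto_intros L)
      show "\<forall>n\<ge>M. norm (w x - w (of_nat (Suc n))) \<le> 1 / (2 * pi * x)"
      proof (intro allI impI)
        fix n assume "M \<le> n"
        then have "x < of_nat (Suc n)" using M by linarith
        from wbound[OF x this] show "norm (w x - w (of_nat (Suc n))) \<le> 1 / (2 * pi * x)"
          by (simp only: norm_minus_commute)
      qed
    qed
  qed
  have "((\<lambda>x. E (of_real x) - L) \<longlongrightarrow> 0) at_top"
  proof (rule Lim_null_comparison)
    show "\<forall>\<^sub>F x in at_top. norm (E (of_real x) - L) \<le> 1 / (pi * x)"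
    proof (rule eventually_mono[OF eventually_gt_at_top[of 0]])
      fix x :: real assume x: "x > 0"
      let ?g = "exp (- (of_real pi * \<i> * (of_real x)^2)) / (2 * of_real pi * \<i> * of_real x)"
      have "norm ((w x - L) - ?g) \<le> 1 / (2 * pi * x) + 1 / (2 * pi * x)"
        using wL[OF x] x by (intro norm_triangle_le_diff[of "w x - L"] add_mono) (auto simp: norm_divide norm_mult)
      then show "norm (E (of_real x) - L) \<le> 1 / (pi * x)" by (simp add: w_def)
    qed
    show "((\<lambda>x. 1 / (pi * x)) \<longlongrightarrow> 0) at_top"
      by real_asymp
  qed
  then have "((\<lambda>x. E (of_real x)) \<longlongrightarrow> L) at_top" by (simp add: LIM_zero_iff)
  moreover have "E (- z) = - E z" for z by (simp add: E_def field_simps)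
  ultimately show thesis using E that by blast
qed

lemma sum_int_telescope:
  fixes u :: "int \<Rightarrow> 'a::ab_group_add"
  assumes "a \<le> b" "d \<ge> 0"
  shows "(\<Sum>k\<in>{a..<b}. u (k + d) - u k) = (\<Sum>r\<in>{0..<d}. u (b + r) - u (a + r))"
  using assms(1)
proof (induction b rule: int_ge_induct)
  case (step b)
  have "{a..<b + 1} = insert b {a..<b}" using step by auto
  moreover have "(\<Sum>r\<in>{0..<d}. u (b + 1 + r)) + u b = (\<Sum>r\<in>{0..<d}. u (b + r)) + u (b + d)"
    using assms(2)
  proof (induction d rule: int_ge_induct)
    case (step d)
    have "{0..<d + 1} = insert d {0..<d}" using step by auto
    with step show ?case by (simp add: algebra_simps)
  qed simp
  ultimately show ?case using step by (simp add: sum_subtractf algebra_simps)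
qed simp

lemma exp_pi_i_even_int: "exp (of_real pi * \<i> * of_int (2 * m) :: complex) = 1"
  unfolding exp_eq_1 by (auto intro: exI[of _ m])

text \<open>Dirichlet's evaluation. Evenness of \<open>c * d\<close> makes \<open>n \<mapsto> exp (- \<pi> \<i> d n^2 / c)\<close> periodic modulo
  \<open>c\<close>, so the sum \<open>F\<close> of the \<open>c\<close> translates of the Gaussian chirp takes the same value at \<open>0\<close> and
  \<open>1\<close>, namely the left-hand side. Completing the square turns the \<open>k\<close>-th Fourier coefficient of
  \<open>F\<close> into \<open>W k = exp (\<pi> \<i> c k^2 / d)\<close> times a Fresnel integral over an interval that moves by
  its own length when \<open>k\<close> grows by \<open>d\<close>. As \<open>W\<close> is periodic modulo \<open>d\<close>, the Fourier series
  telescopes to the dual Gauss sum times the Fresnel integral over the real line.\<close>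

lemma quadratic_gauss_sum_limit:
  fixes c d :: int
  assumes c: "c > 0" and d: "d > 0" and even: "even (c * d)"
    and E: "\<And>z. (E has_field_derivative exp (- (of_real pi * \<i> * z^2))) (at z)"
    and odd: "\<And>z. E (- z) = - E z"
    and L: "((\<lambda>x. E (of_real x)) \<longlongrightarrow> L) at_top"
  shows "(\<Sum>n\<in>{0..<c}. exp (- (of_real pi * \<i> * of_real (of_int (d * n^2) / of_int c)))) =
     2 * L * of_real (sqrt (of_int c / of_int d)) *
       (\<Sum>r\<in>{0..<d}. exp (of_real pi * \<i> * of_real (of_int (c * r^2) / of_int d)))"
proof -
  define \<alpha> where "\<alpha> = sqrt (of_int d / of_int c)"
  have \<alpha>: "\<alpha> > 0" "\<alpha>^2 = of_int d / of_int c" using c d by (simp_all add: \<alpha>_def)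
  define f where "f z = exp (- (of_real pi * \<i> * (of_real \<alpha> * z)^2))" for z :: complex
  define F where "F z = (\<Sum>n\<in>{0..<c}. f (of_int n + z))" for z
  define W where "W k = exp (of_real pi * \<i> * of_real (of_int (c * k^2) / of_int d))" for k :: int
  have f_int: "f (of_int n) = exp (- (of_real pi * \<i> * of_real (of_int (d * n^2) / of_int c)))" for n
  proof -
    have "(of_real \<alpha> * of_int n)^2 = (of_real ((\<alpha> * of_int n)^2) :: complex)" by simp
    also have "(\<alpha> * of_int n)^2 = of_int (d * n^2) / of_int c"
      by (simp add: power_mult_distrib \<alpha>)
    finally show ?thesis by (simp only: f_def mult.assoc)
  qed
  have F0: "F 0 = (\<Sum>n\<in>{0..<c}. exp (- (of_real pi * \<i> * of_real (of_int (d * n^2) / of_int c))))"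
    by (simp add: F_def f_int)
  have fc: "f (of_int c) = 1"
  proof -
    obtain m where m: "c * d = 2 * m" using even by blast
    have "of_int (d * c^2) / of_int c = (of_int (2 * m) :: real)"
      unfolding m[symmetric] using c by (simp add: power2_eq_square)
    then show ?thesis using exp_pi_i_even_int[of "- m"] unfolding f_int by simp
  qed
  have F1: "F 1 = F 0"
  proof -
    have "F 1 - F 0 = (\<Sum>n\<in>{0..<c}. f (of_int (n + 1)) - f (of_int n))"
      by (simp add: F_def sum_subtractf)
    also have "\<dots> = (\<Sum>r\<in>{0..<1}. f (of_int (c + r)) - f (of_int (0 + r)))"
      using c by (intro sum_int_telescope) simp_all
    also have "{0..<1::int} = {0}" by auto
    finally show ?thesis using fc by (simp add: f_def)
  qed
  have hol: "F holomorphic_on UNIV"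
    unfolding F_def f_def by (intro holomorphic_intros)
  have Wper: "W (d * m + k) = W k" for m k
  proof -
    obtain l where l: "c * d = 2 * l" using even by blast
    have "of_int (c * (d * m + k)^2) / of_int d = (of_int (c * k^2) / of_int d + of_int (2 * (c * m * k + l * m^2)) :: real)"
    proof -
      have "c * (d * m + k)^2 = c * k^2 + d * (2 * (c * m * k) + (c * d) * m^2)"
        by (simp add: power2_eq_square algebra_simps)
      also have "\<dots> = c * k^2 + d * (2 * (c * m * k + l * m^2))"
        by (simp add: l algebra_simps)
      finally show ?thesis using d by (simp add: field_simps)
    qed
    then have "W (d * m + k) = W k * exp (of_real pi * \<i> * of_int (2 * (c * m * k + l * m^2)))"
      unfolding W_def exp_add[symmetric] by (simp add: algebra_simps)
    then show ?thesis by (simp only: exp_pi_i_even_int mult_1_right)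
  qed
  define u where "u k = E (of_real (of_int k / \<alpha>))" for k :: int
  have coeff: "((\<lambda>t. F (of_real t) * exp (- (2 * of_real pi * \<i> * of_int k * of_real t))) has_integral
      W k * (u (k + d) - u k) / of_real \<alpha>) {0..1}" for k
  proof -
    let ?z = "\<lambda>n t. of_real \<alpha> * (of_int n + t) + of_real (of_int k / \<alpha>) :: complex"
    have square: "f (of_int n + of_real t) * exp (- (2 * of_real pi * \<i> * of_int k * of_real t)) =
       W k * exp (- (of_real pi * \<i> * (?z n (of_real t))^2))" for n t
    proof -
      have "(?z n (of_real t))^2 = (of_real \<alpha> * (of_int n + of_real t))^2 + 2 * of_int k * of_real t + of_int (2 * (k * n))
         + of_real (of_int (c * k^2) / of_int d)"
      proof -
        have "(of_int k / \<alpha>)^2 = of_int (c * k^2) / of_int d"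
          using c d by (simp add: power_divide \<alpha> field_simps)
        then have "(of_real (of_int k / \<alpha>) :: complex)^2 = of_real (of_int (c * k^2) / of_int d)"
          by (metis of_real_power)
        moreover have "2 * (of_real \<alpha> * (of_int n + of_real t)) * of_real (of_int k / \<alpha>) =
           (2 * of_int k * of_real t + of_int (2 * (k * n)) :: complex)"
          using \<alpha>(1) by (simp add: field_simps)
        ultimately show ?thesis unfolding power2_sum by simp
      qed
      then have "W k * exp (- (of_real pi * \<i> * (?z n (of_real t))^2)) =
         f (of_int n + of_real t) * exp (- (2 * of_real pi * \<i> * of_int k * of_real t)) *
         exp (of_real pi * \<i> * of_int (2 * - (k * n)))"
        unfolding W_def f_def exp_add[symmetric] by (simp add: algebra_simps)
      then show ?thesis by (simp only: exp_pi_i_even_int mult_1_right)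
    qed
    have piece: "((\<lambda>t. f (of_int n + of_real t) * exp (- (2 * of_real pi * \<i> * of_int k * of_real t))) has_integral
       W k * (E (?z (n + 1) 0) - E (?z n 0)) / of_real \<alpha>) {0..1}" for n
    proof -
      have "((\<lambda>t. exp (- (of_real pi * \<i> * (?z n (of_real t))^2)) * of_real \<alpha>) has_integral
         E (?z n (of_real 1)) - E (?z n (of_real 0))) {0..1}"
        by (rule fundamental_theorem_of_calculus)
          (auto intro!: has_vector_derivative_real_field derivative_eq_intros DERIV_chain2[OF E])
      from has_integral_mult_right[OF this, of "W k / of_real \<alpha>"]
      show ?thesis using \<alpha>(1) by (simp add: square add.assoc)
    qed
    have "((\<lambda>t. F (of_real t) * exp (- (2 * of_real pi * \<i> * of_int k * of_real t))) has_integral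
       (\<Sum>n\<in>{0..<c}. W k * (E (?z (n + 1) 0) - E (?z n 0)) / of_real \<alpha>)) {0..1}"
      unfolding F_def sum_distrib_right by (intro has_integral_sum piece) simp
    also have "(\<Sum>n\<in>{0..<c}. W k * (E (?z (n + 1) 0) - E (?z n 0)) / of_real \<alpha>) =
       W k * (\<Sum>n\<in>{0..<c}. E (?z (n + 1) 0) - E (?z n 0)) / of_real \<alpha>"
      by (simp add: sum_distrib_left sum_divide_distrib)
    also have "(\<Sum>n\<in>{0..<c}. E (?z (n + 1) 0) - E (?z n 0)) = E (?z c 0) - E (?z 0 0)"
    proof -
      have "{0..<1::int} = {0}" by auto
      then show ?thesis
        using sum_int_telescope[of 0 c 1 "\<lambda>n. E (?z n 0)"] c by simp
    qed
    also have "?z c 0 = of_real (of_int (k + d) / \<alpha>)"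
    proof -
      have "\<alpha> * of_int c = of_int d / \<alpha>"
        using \<alpha> c by (simp add: field_simps power2_eq_square)
      then have "\<alpha> * of_int c + of_int k / \<alpha> = of_int (k + d) / \<alpha>"
        by (simp add: add_divide_distrib)
      then show ?thesis by (metis add.right_neutral of_real_add of_real_mult of_real_of_int_eq)
    qed
    finally show ?thesis by (simp add: u_def)
  qed
  have partial: "(\<Sum>k\<in>{- int (M * nat d)..<int (M * nat d)}.
        integral {0..1} (\<lambda>t. F (of_real t) * exp (- (2 * of_real pi * \<i> * of_int k * of_real t)))) =
      (\<Sum>r\<in>{0..<d}. W r * (u (d * int M + r) + u (d * int M - r))) / of_real \<alpha>" for M
  proof -
    have K: "int (M * nat d) = d * int M" using d by simp
    have "(\<Sum>k\<in>{- int (M * nat d)..<int (M * nat d)}.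
        integral {0..1} (\<lambda>t. F (of_real t) * exp (- (2 * of_real pi * \<i> * of_int k * of_real t)))) =
       (\<Sum>k\<in>{- (d * int M)..<d * int M}. W (k + d) * u (k + d) - W k * u k) / of_real \<alpha>"
      unfolding K integral_unique[OF coeff] sum_divide_distrib
      using Wper[of 1] by (intro sum.cong refl) (simp add: algebra_simps)
    also have "(\<Sum>k\<in>{- (d * int M)..<d * int M}. W (k + d) * u (k + d) - W k * u k) =
       (\<Sum>r\<in>{0..<d}. W (d * int M + r) * u (d * int M + r) - W (- (d * int M) + r) * u (- (d * int M) + r))"
      using d by (intro sum_int_telescope) simp_all
    also have "\<dots> = (\<Sum>r\<in>{0..<d}. W r * (u (d * int M + r) + u (d * int M - r)))"
    proof (intro sum.cong refl)
      fix r
      have "u (- (d * int M) + r) = - u (d * int M - r)"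
      proof -
        have "of_real (of_int (- (d * int M) + r) / \<alpha>) = - (of_real (of_int (d * int M - r) / \<alpha>) :: complex)"
          unfolding of_real_minus[symmetric] minus_divide_left of_int_minus[symmetric] by (simp add: add.commute)
        then show ?thesis unfolding u_def by (simp only: odd)
      qed
      moreover have "W (- (d * int M) + r) = W r" using Wper[of "- int M" r] by simp
      ultimately show "W (d * int M + r) * u (d * int M + r) - W (- (d * int M) + r) * u (- (d * int M) + r) =
         W r * (u (d * int M + r) + u (d * int M - r))"
        unfolding Wper by (simp add: algebra_simps)
    qed
    finally show ?thesis .
  qed
  have u_lim: "(\<lambda>M. u (d * int M + s)) \<longlonglongrightarrow> L" for s
  proof -
    have "filterlim (\<lambda>M. (real_of_int d / \<alpha>) * real M + of_int s / \<alpha>) at_top sequentially"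
      using \<alpha>(1) d by real_asymp
    then have "filterlim (\<lambda>M. of_int (d * int M + s) / \<alpha>) at_top sequentially"
      by (simp add: add_divide_distrib)
    then show ?thesis unfolding u_def by (rule filterlim_compose[OF L])
  qed
  have "(\<lambda>M. (\<Sum>r\<in>{0..<d}. W r * (u (d * int M + r) + u (d * int M - r))) / of_real \<alpha>)
      \<longlonglongrightarrow> (\<Sum>r\<in>{0..<d}. W r * (L + L)) / of_real \<alpha>"
    using u_lim[of "- _"] \<alpha>(1) by (intro tendsto_intros u_lim) auto
  moreover have "(\<lambda>M. (\<Sum>r\<in>{0..<d}. W r * (u (d * int M + r) + u (d * int M - r))) / of_real \<alpha>) \<longlonglongrightarrow> F 0"
  proof -
    have "filterlim (\<lambda>M. M * nat d) sequentially sequentially"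
      using d by (intro filterlim_subseq) (auto simp: strict_mono_def)
    from filterlim_compose[OF fourier_sum_tendsto[OF hol F1[symmetric]] this]
    show ?thesis unfolding partial .
  qed
  ultimately have "F 0 = (\<Sum>r\<in>{0..<d}. W r * (L + L)) / of_real \<alpha>"
    using LIMSEQ_unique by blast
  also have "\<dots> = 2 * L * of_real (1 / \<alpha>) * (\<Sum>r\<in>{0..<d}. W r)"
    by (simp add: sum_distrib_right[symmetric])
  also have "1 / \<alpha> = sqrt (of_int c / of_int d)"
    by (simp add: \<alpha>_def real_sqrt_divide)
  finally show ?thesis unfolding F0 W_def .
qed

text \<open>The Landsberg--Schaar identity. The constant does not depend on \<open>c\<close> and \<open>d\<close>, so the case
  \<open>c = 2\<close>, \<open>d = 1\<close>, where both sums are explicit, determines it.\<close>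

lemma beta_gauss_reciprocity:
  fixes c d :: int
  assumes c: "c > 0" and d: "d > 0" and even: "even (c * d)"
  shows "beta_gauss d c = exp (- (of_real pi * \<i> / 4)) * beta_gauss (- c) d"
proof -
  obtain E L where E: "\<And>z. (E has_field_derivative exp (- (of_real pi * \<i> * z^2))) (at z)"
      "\<And>z. E (- z) = - E z" "((\<lambda>x. E (of_real x)) \<longlongrightarrow> L) at_top"
    using fresnel_primitive by blast
  have ex2: "exp (- (of_real pi * \<i> * of_real (1 / 2))) = - \<i>"
    using exp_pi_i' by (simp add: exp_eq_polar cis.ctr complex_eq_iff Re_exp Im_exp)
  have ex4: "exp (- (of_real pi * \<i> / 4)) = (1 - \<i>) / of_real (sqrt 2)"
    by (simp add: complex_eq_iff Re_exp Im_exp cos_45 sin_45 field_simps)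
  \<comment> \<open>For \<open>c = 2\<close>, \<open>d = 1\<close> the identity reads \<open>1 - \<i> = 2 * L * sqrt 2\<close>.\<close>
  have "{0..<2::int} = {0, 1}" "{0..<1::int} = {0}" by auto
  then have "1 - \<i> = 2 * L * of_real (sqrt 2)"
    using quadratic_gauss_sum_limit[of 2 1, OF _ _ _ E] ex2 by simp
  then have L: "2 * L = exp (- (of_real pi * \<i> / 4))" unfolding ex4 by (simp add: field_simps)
  have s: "of_int c powr (- (1/2)) * sqrt (of_int c / of_int d) = real_of_int d powr (- (1/2))"
    using c d by (simp add: powr_minus_divide powr_half_sqrt real_sqrt_divide)
  then have sC: "of_real (of_int c powr (- (1/2))) * of_real (sqrt (of_int c / of_int d)) =
      complex_of_real (of_int d powr (- (1/2)))"
    by (metis of_real_mult)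
  show ?thesis
    unfolding beta_gauss_def using c d
    using quadratic_gauss_sum_limit[OF assms E]
    by (simp add: L sC[symmetric])
qed

section \<open>Signs, periodicity and the signed reciprocity laws\<close>

lemma sawtooth_minus: "sawtooth (- x) = - sawtooth x"
proof (cases "x \<in> \<int>")
  case False
  then have "\<lfloor>- x\<rfloor> = - \<lfloor>x\<rfloor> - 1"
    by (simp add: floor_minus ceiling_altdef) (metis Ints_of_int)
  with False show ?thesis by (simp add: sawtooth_def)
qed (simp add: sawtooth_def)

lemma dedekind_sum_minus:
  "dedekind_sum (- d) c = - dedekind_sum d c"
  by (simp add: dedekind_sum_def sawtooth_minus sum_negf[symmetric])

lemma dedekind_sum_add_period:
  fixes c d m :: int assumes "c \<noteq> 0"
  shows "dedekind_sum (d + c * m) \<bar>c\<bar> = dedekind_sum d \<bar>c\<bar>"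
proof -
  have eq: "k * (d + c * m) = k * d + \<bar>c\<bar> * (sgn c * (k * m))" for k
    using assms by (cases "c > 0") (simp_all add: algebra_simps)
  have "k * (d + c * m) mod \<bar>c\<bar> = k * d mod \<bar>c\<bar>" "\<bar>c\<bar> dvd k * (d + c * m) \<longleftrightarrow> \<bar>c\<bar> dvd k * d" for k
    unfolding eq by (simp_all only: mod_mult_self2 dvd_add_left_iff dvd_triv_left)
  moreover have "\<bar>c\<bar> > 0" using assms by simp
  ultimately show ?thesis
    unfolding dedekind_sum_def by (simp only: sawtooth_of_int_divide abs_idempotent)
qed

text \<open>Both sides of the reciprocity law are odd in each of \<open>c\<close> and \<open>d\<close> once the Dedekind sums
  carry the sign of the modulus; this is the form in which they enter \<open>beta1_tilde\<close>.\<close>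

lemma dedekind_sum_reciprocity_signed:
  fixes c d :: int
  assumes c: "c \<noteq> 0" and d: "d \<noteq> 0" and cop: "coprime c d"
  shows "of_int (sgn c) * dedekind_sum d \<bar>c\<bar> + of_int (sgn d) * dedekind_sum c \<bar>d\<bar> =
    - of_int (sgn (c * d)) / 4
    + (of_int d / of_int c + of_int c / of_int d + 1 / (of_int c * of_int d)) / 12"
proof -
  define e f :: real where "e = of_int (sgn c)" and "f = of_int (sgn d)"
  define R :: real where "R = of_int d / of_int c + of_int c / of_int d + 1 / (of_int c * of_int d)"
  have signs: "e = 1 \<or> e = - 1" "f = 1 \<or> f = - 1"
    using c d by (auto simp: e_def f_def sgn_if)
  have abs: "of_int \<bar>c\<bar> = e * of_int c" "of_int \<bar>d\<bar> = f * of_int d"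
    by (simp_all add: e_def f_def abs_if sgn_if)
  have sums: "dedekind_sum \<bar>d\<bar> \<bar>c\<bar> = f * dedekind_sum d \<bar>c\<bar>" "dedekind_sum \<bar>c\<bar> \<bar>d\<bar> = e * dedekind_sum c \<bar>d\<bar>"
    using c d by (auto simp: e_def f_def abs_if sgn_if dedekind_sum_minus)
  have "dedekind_sum \<bar>d\<bar> \<bar>c\<bar> + dedekind_sum \<bar>c\<bar> \<bar>d\<bar> =
    - 1/4 + (of_int \<bar>d\<bar> / of_int \<bar>c\<bar> + of_int \<bar>c\<bar> / of_int \<bar>d\<bar> + 1 / (of_int \<bar>c\<bar> * of_int \<bar>d\<bar>)) / 12"
    using assms by (intro dedekind_sum_reciprocity) auto
  also have "of_int \<bar>d\<bar> / of_int \<bar>c\<bar> + of_int \<bar>c\<bar> / of_int \<bar>d\<bar> + 1 / (of_int \<bar>c\<bar> * of_int \<bar>d\<bar>) = e * f * R"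
    unfolding abs R_def using signs by (elim disjE) simp_all
  finally have "f * dedekind_sum d \<bar>c\<bar> + e * dedekind_sum c \<bar>d\<bar> = - 1/4 + e * f * R / 12"
    unfolding sums .
  then have "e * dedekind_sum d \<bar>c\<bar> + f * dedekind_sum c \<bar>d\<bar> = - (e * f) / 4 + R / 12"
    using signs by (elim disjE) simp_all
  then show ?thesis by (simp add: e_def f_def R_def sgn_mult)
qed

lemma beta_gauss_minus_minus: "beta_gauss (- d) (- c) = beta_gauss d c"
  by (simp add: beta_gauss_def)

lemma beta_gauss_minus: "beta_gauss (- d) c = cnj (beta_gauss d c)"
  by (simp add: beta_gauss_def exp_cnj)

lemma beta_gauss_add_period: "beta_gauss (d + 2 * c * m) c = beta_gauss d c"
proof (cases "c = 0")
  case False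
  have "exp (- (of_real pi * \<i> * of_real (of_int ((d + 2 * c * m) * n^2) / of_int c))) =
        exp (- (of_real pi * \<i> * of_real (of_int (d * n^2) / of_int c)))" for n
  proof -
    have "of_int ((d + 2 * c * m) * n^2) / of_int c = (of_int (d * n^2) / of_int c + of_int (2 * (m * n^2)) :: real)"
      using False by (simp add: field_simps)
    then have "exp (- (of_real pi * \<i> * of_real (of_int ((d + 2 * c * m) * n^2) / of_int c))) =
        exp (- (of_real pi * \<i> * of_real (of_int (d * n^2) / of_int c))) * exp (of_real pi * \<i> * of_int (2 * - (m * n^2)))"
      unfolding exp_add[symmetric] by (simp add: algebra_simps)
    then show ?thesis by (simp only: exp_pi_i_even_int mult_1_right)
  qed
  then show ?thesis by (simp only: beta_gauss_def)
qed simp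

text \<open>Changing the sign of one argument conjugates both Gauss sums, so the constant becomes
  the conjugate eighth root of unity.\<close>

lemma beta_gauss_reciprocity_signed:
  fixes c d :: int
  assumes c: "c \<noteq> 0" and d: "d \<noteq> 0" and even: "even (c * d)"
  shows "beta_gauss d c = exp (- (of_real pi * \<i> * of_real (of_int (sgn (c * d)) / 4))) * beta_gauss (- c) d"
proof -
  have conj: "cnj (exp (- (of_real pi * \<i> / 4))) = exp (of_real pi * \<i> / 4)"
    by (simp add: exp_cnj)
  consider "c > 0" "d > 0" | "c < 0" "d < 0" | "c > 0" "d < 0" | "c < 0" "d > 0"
    using c d by linarith
  then show ?thesis
  proof cases
    case 1
    then show ?thesis using beta_gauss_reciprocity[of c d] even by simp
  next
    case 2
    then show ?thesis using beta_gauss_reciprocity[of "- c" "- d"] even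
      beta_gauss_minus_minus[of d c] beta_gauss_minus_minus[of "- c" d]
      by (simp add: sgn_mult)
  next
    case 3
    then have "beta_gauss (- d) c = exp (- (of_real pi * \<i> / 4)) * beta_gauss (- c) (- d)"
      using beta_gauss_reciprocity[of c "- d"] even by simp
    then have "cnj (beta_gauss (- d) c) = exp (of_real pi * \<i> / 4) * cnj (beta_gauss (- c) (- d))"
      by (simp only: complex_cnj_mult conj)
    then show ?thesis
      using 3 beta_gauss_minus_minus[of "- c" d] by (simp add: beta_gauss_minus sgn_mult)
  next
    case 4
    then have "beta_gauss d (- c) = exp (- (of_real pi * \<i> / 4)) * beta_gauss c d"
      using beta_gauss_reciprocity[of "- c" d] even by simp
    then have "cnj (beta_gauss d (- c)) = exp (of_real pi * \<i> / 4) * cnj (beta_gauss c d)"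
      by (simp only: complex_cnj_mult conj)
    then show ?thesis
      using 4 beta_gauss_minus_minus[of d c]
      by (simp add: beta_gauss_minus[symmetric] sgn_mult)
  qed
qed

section \<open>The character \<open>chi\<close> with modulus \<open>d\<close>\<close>

lemma dedekind_sum_modulus_1: "dedekind_sum d 1 = 0"
proof -
  have "{0..<1::int} = {0}" by auto
  then show ?thesis by (simp add: dedekind_sum_def sawtooth_def)
qed

lemma beta_gauss_modulus_1: "\<bar>c\<bar> = 1 \<Longrightarrow> beta_gauss d c = 1"
proof -
  assume "\<bar>c\<bar> = 1"
  moreover have "{0..<1::int} = {0}" by auto
  ultimately show ?thesis by (simp add: beta_gauss_def)
qed

text \<open>Reciprocity moves the modulus from \<open>c\<close> to \<open>d\<close>, and the signs \<open>sgn (c * d)\<close> that the two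
  reciprocity laws produce cancel in the quotient. Since \<open>d\<close> is odd it never vanishes, so the
  result holds for \<open>c = 0\<close> as well, and it depends on \<open>c\<close> visibly only through its residue
  modulo \<open>2 * d\<close> and the linear term \<open>- c / (12 * d)\<close>.\<close>

lemma chi_reciprocal:
  assumes g: "g \<in> Gamma2" and b: "b = g $ 1 $ 2" and c: "c = g $ 2 $ 1" and d: "d = g $ 2 $ 2"
  shows "chi g = exp (- (of_real pi * \<i> *
      of_real (of_int (b - c) / (12 * of_int d) + of_int (sgn d) * dedekind_sum c \<bar>d\<bar>)))
    / beta_gauss (- c) d"
proof -
  define a where "a = g $ 1 $ 1"
  have det: "a * d - b * c = 1" and odd: "odd d" and even: "even c"
    using g by (simp_all add: Gamma2_iff a_def b c d)
  then have d0: "d \<noteq> 0" by auto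
  show ?thesis
  proof (cases "c = 0")
    case True
    then have "a * d = 1" using det by simp
    then have ad: "a = d" "\<bar>d\<bar> = 1" by (auto simp: zmult_eq_1_iff)
    have "chi g = exp (- (of_real pi * \<i> * of_real (of_int b / (12 * of_int d))))"
      using True ad(1) by (simp add: chi_def beta1_tilde_def beta_tilde_def a_def b c d)
    then show ?thesis
      using True ad(2) by (simp add: dedekind_sum_modulus_1 beta_gauss_modulus_1)
  next
    case False
    have cop: "coprime c d"
    proof (rule coprimeI)
      fix k assume "k dvd c" "k dvd d"
      then have "k dvd a * d - b * c" by (simp add: dvd_diff)
      then show "is_unit k" using det by simp
    qed
    define \<sigma> where "\<sigma> = real_of_int (sgn (c * d)) / 4"
    define \<phi> where "\<phi> = of_int (b - c) / (12 * of_int d) + of_int (sgn d) * dedekind_sum c \<bar>d\<bar>"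
    have "of_int (a + d) / (12 * of_int c) - of_int (sgn c) * dedekind_sum d \<bar>c\<bar> = \<phi> + \<sigma>"
    proof -
      \<comment> \<open>The determinant turns \<open>a / c - 1 / (c * d)\<close> into \<open>b / d\<close>.\<close>
      have "real_of_int a * of_int d - of_int b * of_int c = 1"
        using det by (metis of_int_1 of_int_diff of_int_mult)
      then have "real_of_int a / of_int c - 1 / (of_int c * of_int d) = of_int b / of_int d"
        using False d0 by (simp add: field_simps)
      then show ?thesis
        using dedekind_sum_reciprocity_signed[OF False d0 cop]
        unfolding \<phi>_def \<sigma>_def by (simp add: add_divide_distrib diff_divide_distrib)
    qed
    then have "beta1_tilde g = exp (- (of_real pi * \<i> * of_real \<sigma>)) * exp (- (of_real pi * \<i> * of_real \<phi>))"
      using False unfolding exp_add[symmetric]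
      by (simp add: beta1_tilde_def Let_def a_def[symmetric] b[symmetric] c[symmetric] d[symmetric]
          algebra_simps del: of_int_add of_real_diff)
    moreover have "beta_tilde g = exp (- (of_real pi * \<i> * of_real \<sigma>)) * beta_gauss (- c) d"
      using False beta_gauss_reciprocity_signed[OF False d0] even
      by (simp add: beta_tilde_def \<sigma>_def c[symmetric] d[symmetric])
    ultimately show ?thesis by (simp add: chi_def \<phi>_def)
  qed
qed

theorem lemma7p13:
  fixes g :: "int^2^2"
  assumes "g \<in> Gamma2"
  shows "chi (- g) = chi g \<and>
         chi (g ** n2) = chi g * chi n2 \<and>
         chi (g ** n2_minus) = chi g * chi n2_minus"
proof (intro conjI)
  define a b c d where "a = g $ 1 $ 1" and "b = g $ 1 $ 2" and "c = g $ 2 $ 1" and "d = g $ 2 $ 2"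
  note abcd = a_def b_def c_def d_def
  have det: "a * d - b * c = 1" and "odd d"
    using assms by (simp_all add: Gamma2_iff abcd)
  then have d0: "d \<noteq> 0" by auto
  note chi_g = chi_reciprocal[OF assms b_def c_def d_def]

  have "chi (- g) = exp (- (of_real pi * \<i> *
      of_real (of_int (- b - (- c)) / (12 * of_int (- d)) + of_int (sgn (- d)) * dedekind_sum (- c) \<bar>- d\<bar>)))
    / beta_gauss (- (- c)) (- d)"
    by (rule chi_reciprocal[OF Gamma2_uminus[OF assms]]) (simp_all add: abcd)
  also have "of_int (- b - (- c)) / (12 * of_int (- d)) + of_int (sgn (- d)) * dedekind_sum (- c) \<bar>- d\<bar>
      = (of_int (b - c) / (12 * of_int d) + of_int (sgn d) * dedekind_sum c \<bar>d\<bar> :: real)"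
    using d0 by (simp add: dedekind_sum_minus sgn_minus field_simps)
  also have "beta_gauss (- (- c)) (- d) = beta_gauss (- c) d"
    by (rule beta_gauss_minus_minus)
  finally show "chi (- g) = chi g"
    unfolding chi_g .

  \<comment> \<open>Right multiplication by \<open>n2\<close> fixes \<open>a\<close> and \<open>c\<close> and adds \<open>2 * a\<close> to \<open>b\<close>, \<open>2 * c\<close> to \<open>d\<close>,
    so the defining formulas already use the right modulus.\<close>
  have n2: "(g ** n2) $ 1 $ 1 = a" "(g ** n2) $ 1 $ 2 = b + 2 * a"
    "(g ** n2) $ 2 $ 1 = c" "(g ** n2) $ 2 $ 2 = d + 2 * c"
    by (simp_all add: matrix_matrix_mult_def sum_2 n2_def abcd)
  have chi_n2: "chi n2 = exp (- (of_real pi * \<i> * of_real (1 / 6)))"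
    by (simp add: chi_def beta1_tilde_def beta_tilde_def n2_def mult.commute)
  show "chi (g ** n2) = chi g * chi n2"
  proof (cases "c = 0")
    case True
    then have "a \<noteq> 0" using det by auto
    then have "of_int (b + 2 * a) / (12 * of_int a) = (of_int b / (12 * of_int a) + 1 / 6 :: real)"
      by (simp add: field_simps)
    then have "chi (g ** n2) = exp (- (of_real pi * \<i> * of_real (of_int b / (12 * of_int a) + 1 / 6)))"
      using True by (simp only: chi_def beta1_tilde_def beta_tilde_def Let_def n2 if_True div_by_1 simp_thms)
    also have "\<dots> = exp (- (of_real pi * \<i> * of_real (of_int b / (12 * of_int a)))) * chi n2"
      unfolding chi_n2 exp_add[symmetric] by (simp add: algebra_simps)
    also have "exp (- (of_real pi * \<i> * of_real (of_int b / (12 * of_int a)))) = chi g"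
      using True by (simp add: chi_def beta1_tilde_def beta_tilde_def abcd)
    finally show ?thesis .
  next
    case False
    define \<phi> where "\<phi> = of_int (a + d) / (12 * of_int c) - of_int (sgn c) * dedekind_sum d \<bar>c\<bar>"
    have "dedekind_sum (d + 2 * c) \<bar>c\<bar> = dedekind_sum d \<bar>c\<bar>"
      using dedekind_sum_add_period[OF False, of d 2] by (simp add: mult.commute)
    moreover have "of_int (a + (d + 2 * c)) / (12 * of_int c) = (of_int (a + d) / (12 * of_int c) + 1 / 6 :: real)"
      using False by (simp add: field_simps)
    ultimately have "of_int (a + (d + 2 * c)) / (12 * of_int c) - of_int (sgn c) * dedekind_sum (d + 2 * c) \<bar>c\<bar> = \<phi> + 1 / 6"
      by (simp add: \<phi>_def)
    then have "beta1_tilde (g ** n2) = exp (- (of_real pi * \<i> * of_real (\<phi> + 1 / 6)))"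
      using False by (simp only: beta1_tilde_def Let_def n2 if_False)
    also have "\<dots> = exp (- (of_real pi * \<i> * of_real \<phi>)) * chi n2"
      unfolding chi_n2 exp_add[symmetric] by (simp add: algebra_simps)
    also have "exp (- (of_real pi * \<i> * of_real \<phi>)) = beta1_tilde g"
      using False by (simp only: beta1_tilde_def Let_def abcd[symmetric] if_False \<phi>_def)
    finally have "beta1_tilde (g ** n2) = beta1_tilde g * chi n2" .
    moreover have "beta_tilde (g ** n2) = beta_tilde g"
      using beta_gauss_add_period[of d c 1] by (simp add: beta_tilde_def n2 abcd)
    ultimately show ?thesis by (simp add: chi_def)
  qed

  \<comment> \<open>Right multiplication by \<open>n2_minus\<close> fixes \<open>b\<close> and \<open>d\<close> and adds \<open>2 * d\<close> to \<open>c\<close>,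
    so the reciprocal formula is periodic up to the linear term.\<close>
  have n2m: "(g ** n2_minus) $ 1 $ 2 = b" "(g ** n2_minus) $ 2 $ 1 = c + 2 * d"
    "(g ** n2_minus) $ 2 $ 2 = d"
    by (simp_all add: matrix_matrix_mult_def sum_2 n2_minus_def abcd)
  have "chi n2_minus = exp (- (of_real pi * \<i> *
      of_real (of_int (0 - 2) / (12 * of_int 1) + of_int (sgn 1) * dedekind_sum 2 \<bar>1\<bar>)))
    / beta_gauss (- 2) 1"
    by (rule chi_reciprocal[OF n2_minus_in_Gamma2]) (simp_all add: n2_minus_def)
  then have chi_n2m: "chi n2_minus = exp (- (of_real pi * \<i> * of_real (- (1 / 6))))"
    by (simp add: dedekind_sum_modulus_1 beta_gauss_modulus_1)
  define \<phi> where "\<phi> = of_int (b - c) / (12 * of_int d) + of_int (sgn d) * dedekind_sum c \<bar>d\<bar>"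
  have "dedekind_sum (c + 2 * d) \<bar>d\<bar> = dedekind_sum c \<bar>d\<bar>"
    using dedekind_sum_add_period[OF d0, of c 2] by (simp add: mult.commute)
  moreover have "of_int (b - (c + 2 * d)) / (12 * of_int d) = (of_int (b - c) / (12 * of_int d) + - (1 / 6) :: real)"
    using d0 by (simp add: field_simps)
  ultimately have "of_int (b - (c + 2 * d)) / (12 * of_int d) + of_int (sgn d) * dedekind_sum (c + 2 * d) \<bar>d\<bar> = \<phi> + - (1 / 6)"
    by (simp add: \<phi>_def)
  moreover have "beta_gauss (- (c + 2 * d)) d = beta_gauss (- c) d"
    using beta_gauss_add_period[of "- c" d "- 1"] by simp
  ultimately have "chi (g ** n2_minus) = exp (- (of_real pi * \<i> * of_real (\<phi> + - (1 / 6)))) / beta_gauss (- c) d"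
    using chi_reciprocal[OF Gamma2_mult[OF assms n2_minus_in_Gamma2] n2m[symmetric]] by simp
  also have "exp (- (of_real pi * \<i> * of_real (\<phi> + - (1 / 6)))) = exp (- (of_real pi * \<i> * of_real \<phi>)) * chi n2_minus"
    unfolding chi_n2m exp_add[symmetric] by (simp add: algebra_simps)
  finally show "chi (g ** n2_minus) = chi g * chi n2_minus"
    unfolding chi_g \<phi>_def by simp
qed

end
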